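(* Let $E$ be the infinite dimensional Grassmann algebra over a field $F$ of characteristic zero. Let $m<0<n$ be integers with $\gcd(m,n)=1$. Then the $\mathbb{Z}$-graded algebra $E_{(m,n)}^{(\infty,\infty)}$ is PI-equivalent to $E_{(-1,1)}^{(\infty,\infty)}$ or it is PI-equivalent to $E_{(-1,2)}^{(\infty,\infty)}$; that is, $T_{\mathbb{Z}}(E_{(m,n)}^{(\infty,\infty)})=T_{\mathbb{Z}}(E_{(-1,1)}^{(\infty,\infty)})$ or $T_{\mathbb{Z}}(E_{(m,n)}^{(\infty,\infty)})=T_{\mathbb{Z}}(E_{(-1,2)}^{(\infty,\infty)})$.
   Context: All algebras are associative and unitary over $F$. $L$ is the vector space with basis $e_1,e_2,\ldots$, and $E$ has basis $B_E$ consisting of $1$ and all products $e_{i_1}\cdots e_{i_k}$ with $i_1<\cdots<i_k$, $k\ge 1$, with multiplication induced by $e_ie_j=-e_je_i$ for all $i,j$. For integers $m<n$, the $\mathbb{Z}$-graded algebra $E_{(m,n)}^{(\infty,\infty)}=\bigoplus_{r\in\mathbb{Z}}A_r$ is defined as follows: split the set $\{e_1,e_2,\ldots\}$ into two disjoint infinite subsets, spanning subspaces $L_m^{\infty}$ and $L_n^{\infty}$ with $L=L_m^{\infty}\oplus L_n^{\infty}$; set $\|e_k\|=m$ if $e_k\in L_m^\infty$ and $\|e_k\|=n$ if $e_k\in L_n^\infty$, and $\|e_{k_1}\cdots e_{k_s}\|=\|e_{k_1}\|+\cdots+\|e_{k_s}\|$ (and $\|1\|=0$); $A_r$ is the span of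 the elements of $B_E$ of degree $r$. Graded identities: $F\langle X|\mathbb{Z}\rangle$ is the free unitary associative algebra on the disjoint union $X=\bigcup_{i\in\mathbb{Z}}X_i$, $X_i=\{x_1^i,x_2^i,\ldots\}$, graded by giving the variables in $X_i$ degree $i$. $f(x_1^{l_1},\ldots,x_r^{l_r})$ is a graded identity of a $\mathbb{Z}$-graded algebra $A$ if $f(a_1,\ldots,a_r)=0$ for all $a_i\in A_{l_i}$; $T_{\mathbb{Z}}(A)$ is the set of all graded identities of $A$. Two $\mathbb{Z}$-graded algebras $A,B$ are PI-equivalent (as $\mathbb{Z}$-graded algebras) if $T_{\mathbb{Z}}(A)=T_{\mathbb{Z}}(B)$. *)

theory Defs
  imports Complex_Main "HOL-Library.Poly_Mapping"
begin

section \<open>The Grassmann algebra\<close>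

definition inversion_sign :: "nat set \<Rightarrow> nat set \<Rightarrow> 'a::field" where
  "inversion_sign S T = (-1) ^ card {(s, t). s \<in> S \<and> t \<in> T \<and> t < s}"

lemma inversion_sign_Un_left:
  assumes "finite A" "finite B" "finite C" "A \<inter> B = {}"
  shows "inversion_sign (A \<union> B) C = (inversion_sign A C * inversion_sign B C :: 'a::field)"
proof -
  let ?f = "\<lambda>S. {(s, t). s \<in> S \<and> t \<in> C \<and> t < s}"
  have fin: "finite (?f S)" if "finite S" for S
    by (rule finite_subset[of _ "S \<times> C"]) (use that assms in auto)
  have "?f (A \<union> B) = ?f A \<union> ?f B" by auto
  moreover have "?f A \<inter> ?f B = {}" using assms by auto
  ultimately have "card (?f (A \<union> B)) = card (?f A) + card (?f B)"
    using fin assms by (simp add: card_Un_disjoint)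
  then show ?thesis by (simp add: inversion_sign_def power_add)
qed

lemma inversion_sign_Un_right:
  assumes "finite A" "finite B" "finite C" "B \<inter> C = {}"
  shows "inversion_sign A (B \<union> C) = (inversion_sign A B * inversion_sign A C :: 'a::field)"
proof -
  let ?f = "\<lambda>T. {(s, t). s \<in> A \<and> t \<in> T \<and> t < s}"
  have fin: "finite (?f T)" if "finite T" for T
    by (rule finite_subset[of _ "A \<times> T"]) (use that assms in auto)
  have "?f (B \<union> C) = ?f B \<union> ?f C" by auto
  moreover have "?f B \<inter> ?f C = {}" using assms by auto
  ultimately have "card (?f (B \<union> C)) = card (?f B) + card (?f C)"
    using fin assms by (simp add: card_Un_disjoint)
  then show ?thesis by (simp add: inversion_sign_def power_add)
qed

lemma inversion_sign_empty [simp]: "inversion_sign {} T = 1" "inversion_sign S {} = 1"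
  by (simp_all add: inversion_sign_def)

text \<open>
  An element is its family of coordinates: the coordinate at a finite set
  \<open>{i\<^sub>1 < \<dots> < i\<^sub>k}\<close> is the coefficient of the basis element \<open>e\<^sub>i\<^sub>1 \<cdots> e\<^sub>i\<^sub>k\<close>
  (of \<open>1\<close> for the empty set). Generators are indexed from \<open>0\<close>.
\<close>

typedef (overloaded) 'a grassmann =
  "{f :: nat set \<Rightarrow> 'a::field. finite {S. f S \<noteq> 0} \<and> (\<forall>S. infinite S \<longrightarrow> f S = 0)}"
  morphisms coord Abs_grassmann
  by (rule exI[of _ "\<lambda>_. 0"]) simp

setup_lifting type_definition_grassmann

lemma finite_coord: "finite {S. coord x S \<noteq> 0}"
  and coord_infinite: "infinite S \<Longrightarrow> coord x S = 0"
  using coord[of x] by auto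

lemma grassmann_eqI: "(\<And>S. coord x S = coord y S) \<Longrightarrow> x = y"
  by (simp add: coord_inject[symmetric] fun_eq_iff)

instantiation grassmann :: (field) ring_1
begin

lift_definition zero_grassmann :: "'a grassmann" is "\<lambda>_. 0" by simp

lift_definition one_grassmann :: "'a grassmann" is "\<lambda>S. if S = {} then 1 else 0"
  by auto

lift_definition plus_grassmann :: "'a grassmann \<Rightarrow> 'a grassmann \<Rightarrow> 'a grassmann"
  is "\<lambda>f g S. f S + g S"
proof -
  fix f g :: "nat set \<Rightarrow> 'a"
  assume a: "finite {S. f S \<noteq> 0} \<and> (\<forall>S. infinite S \<longrightarrow> f S = 0)"
    "finite {S. g S \<noteq> 0} \<and> (\<forall>S. infinite S \<longrightarrow> g S = 0)"
  have "finite {S. f S + g S \<noteq> 0}"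
    by (rule finite_subset[of _ "{S. f S \<noteq> 0} \<union> {S. g S \<noteq> 0}"]) (use a in auto)
  then show "finite {S. f S + g S \<noteq> 0} \<and> (\<forall>S. infinite S \<longrightarrow> f S + g S = 0)"
    using a by simp
qed

lift_definition uminus_grassmann :: "'a grassmann \<Rightarrow> 'a grassmann" is "\<lambda>f S. - f S"
  by simp

definition minus_grassmann :: "'a grassmann \<Rightarrow> 'a grassmann \<Rightarrow> 'a grassmann" where
  "minus_grassmann x y = x + - y"

text \<open>
  For disjoint \<open>S\<close>, \<open>T\<close>, sorting \<open>e\<^sub>S e\<^sub>T\<close> into increasing order with the rule
  \<open>e\<^sub>i e\<^sub>j = - e\<^sub>j e\<^sub>i\<close> gives \<open>inversion_sign S T\<close> times the basis element of \<open>S \<union> T\<close>; if \<open>S\<close>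
  and \<open>T\<close> meet, the product vanishes.
\<close>

lift_definition times_grassmann :: "'a grassmann \<Rightarrow> 'a grassmann \<Rightarrow> 'a grassmann"
  is "\<lambda>f g U. \<Sum>S\<in>Pow U. inversion_sign S (U - S) * f S * g (U - S)"
proof -
  fix f g :: "nat set \<Rightarrow> 'a"
  assume a: "finite {S. f S \<noteq> 0} \<and> (\<forall>S. infinite S \<longrightarrow> f S = 0)"
    "finite {S. g S \<noteq> 0} \<and> (\<forall>S. infinite S \<longrightarrow> g S = 0)"
  let ?h = "\<lambda>U. \<Sum>S\<in>Pow U. inversion_sign S (U - S) * f S * g (U - S)"
  have "{U. ?h U \<noteq> 0} \<subseteq> (\<lambda>(S, T). S \<union> T) ` ({S. f S \<noteq> 0} \<times> {S. g S \<noteq> 0})"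
  proof
    fix U assume "U \<in> {U. ?h U \<noteq> 0}"
    then have "?h U \<noteq> 0" by simp
    then obtain S where "S \<in> Pow U" "inversion_sign S (U - S) * f S * g (U - S) \<noteq> 0"
      by (metis (no_types, lifting) sum.not_neutral_contains_not_neutral)
    then have "U = (\<lambda>(S, T). S \<union> T) (S, U - S)" "(S, U - S) \<in> {S. f S \<noteq> 0} \<times> {S. g S \<noteq> 0}"
      by auto
    then show "U \<in> (\<lambda>(S, T). S \<union> T) ` ({S. f S \<noteq> 0} \<times> {S. g S \<noteq> 0})" by (rule image_eqI)
  qed
  then have "finite {U. ?h U \<noteq> 0}"
    by (rule finite_subset) (use a in auto)
  then show "finite {U. ?h U \<noteq> 0} \<and> (\<forall>S. infinite S \<longrightarrow> ?h S = 0)"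
    by simp
qed

lemma grassmann_mult_assoc: "(x * y) * z = x * (y * z)" for x y z :: "'a grassmann"
proof (rule grassmann_eqI)
  fix U :: "nat set"
  show "coord ((x * y) * z) U = coord (x * (y * z)) U"
  proof (cases "finite U")
    case False
    then show ?thesis by (simp add: coord_infinite)
  next
    case True
    let ?s = "inversion_sign :: nat set \<Rightarrow> nat set \<Rightarrow> 'a"
    have "coord ((x * y) * z) U = (\<Sum>S\<in>Pow U. \<Sum>R\<in>Pow S.
        ?s S (U - S) * (?s R (S - R) * coord x R * coord y (S - R)) * coord z (U - S))"
      by (simp add: times_grassmann.rep_eq sum_distrib_left sum_distrib_right)
    also have "\<dots> = (\<Sum>(S, R)\<in>Sigma (Pow U) Pow.
        ?s S (U - S) * (?s R (S - R) * coord x R * coord y (S - R)) * coord z (U - S))"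
      by (rule sum.Sigma) (use True finite_subset in auto)
    also have "\<dots> = (\<Sum>(R, T)\<in>Sigma (Pow U) (\<lambda>R. Pow (U - R)).
        ?s R (U - R) * coord x R * (?s T (U - R - T) * coord y T * coord z (U - R - T)))"
    proof (rule sum.reindex_bij_witness[where i = "\<lambda>(R, T). (R \<union> T, R)"
          and j = "\<lambda>(S, R). (R, S - R)"], goal_cases)
      case (5 p)
      then obtain S R where p: "p = (S, R)" "S \<subseteq> U" "R \<subseteq> S" by auto
      have f: "finite S" "finite R" "finite (U - S)" "finite (S - R)"
        using p True by (auto intro: finite_subset)
      have e: "U - R - (S - R) = U - S" "U - R = (S - R) \<union> (U - S)" using p by auto
      have "?s S (U - S) = ?s R (U - S) * ?s (S - R) (U - S)"
        using inversion_sign_Un_left[of R "S - R" "U - S"] f p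
        by (metis Diff_disjoint Diff_partition)
      moreover have "?s R (U - R) = ?s R (S - R) * ?s R (U - S)"
        unfolding e(2) by (rule inversion_sign_Un_right) (use f in auto)
      ultimately show ?case by (simp add: p e(1))
    qed auto
    also have "\<dots> = (\<Sum>R\<in>Pow U. \<Sum>T\<in>Pow (U - R).
        ?s R (U - R) * coord x R * (?s T (U - R - T) * coord y T * coord z (U - R - T)))"
      by (rule sum.Sigma[symmetric]) (use True in auto)
    also have "\<dots> = coord (x * (y * z)) U"
      by (simp add: times_grassmann.rep_eq sum_distrib_left)
    finally show ?thesis .
  qed
qed

instance
proof
  fix x y z :: "'a grassmann"
  show "x + y + z = x + (y + z)" by transfer (simp add: fun_eq_iff add.assoc)
  show "x + y = y + x" by transfer (simp add: fun_eq_iff add.commute)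
  show "0 + x = x" by transfer simp
  show "- x + x = 0" by transfer simp
  show "x - y = x + - y" by (rule minus_grassmann_def)
  show "x * y * z = x * (y * z)" by (rule grassmann_mult_assoc)
  show "(x + y) * z = x * z + y * z"
    by transfer (simp add: fun_eq_iff algebra_simps sum.distrib)
  show "x * (y + z) = x * y + x * z"
    by transfer (simp add: fun_eq_iff algebra_simps sum.distrib)
  show "(0::'a grassmann) \<noteq> 1" by transfer (auto simp: fun_eq_iff)
  show "1 * x = x"
  proof (rule grassmann_eqI)
    fix U show "coord (1 * x) U = coord x U"
    proof (cases "finite U")
      case True
      have "coord (1 * x) U = (\<Sum>S\<in>Pow U. if S = {} then coord x U else 0)"
        unfolding times_grassmann.rep_eq one_grassmann.rep_eq by (rule sum.cong) auto
      then show ?thesis using True by simp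
    qed (simp add: coord_infinite)
  qed
  show "x * 1 = x"
  proof (rule grassmann_eqI)
    fix U show "coord (x * 1) U = coord x U"
    proof (cases "finite U")
      case True
      have "coord (x * 1) U = (\<Sum>S\<in>Pow U. if S = U then coord x U else 0)"
        unfolding times_grassmann.rep_eq one_grassmann.rep_eq by (rule sum.cong) auto
      then show ?thesis using True by simp
    qed (simp add: coord_infinite)
  qed
qed

end

lift_definition scale_grassmann :: "'a::field \<Rightarrow> 'a grassmann \<Rightarrow> 'a grassmann"
  is "\<lambda>c f S. c * f S"
  by (auto elim: finite_subset[rotated])

interpretation grassmann: vector_space scale_grassmann
  by unfold_locales (transfer, simp add: fun_eq_iff algebra_simps)+

lemma scale_grassmann_mult_left: "scale_grassmann c x * y = scale_grassmann c (x * y)"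
  and scale_grassmann_mult_right: "x * scale_grassmann c y = scale_grassmann c (x * y)"
  by (transfer, simp add: fun_eq_iff sum_distrib_left mult_ac)+

lift_definition gen :: "nat \<Rightarrow> 'a::field grassmann" is "\<lambda>i S. if S = {i} then 1 else 0"
  by auto

lemma coord_gen_mult:
  assumes "finite U"
  shows "coord (gen i * x) U =
    (if i \<in> U then inversion_sign {i} (U - {i}) * coord x (U - {i}) else 0)"
proof -
  have "coord (gen i * x) U =
      (\<Sum>S\<in>Pow U. if S = {i} then inversion_sign {i} (U - {i}) * coord x (U - {i}) else 0)"
    unfolding times_grassmann.rep_eq gen.rep_eq by (rule sum.cong) auto
  then show ?thesis using assms by simp
qed

lemma gen_anticommute: "gen i * gen j = - (gen j * gen i :: 'a::field grassmann)"
proof (rule grassmann_eqI)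
  have inv: "{(s, t). s = a \<and> t = b \<and> t < s} = (if b < a then {(a, b)} else {})" for a b :: nat
    by auto
  fix U show "coord (gen i * gen j :: 'a grassmann) U = coord (- (gen j * gen i)) U"
  proof (cases "finite U")
    case False
    then show ?thesis by (simp add: coord_infinite)
  next
    case True
    consider "i \<noteq> j" "U = {i, j}" | "i = j \<or> U \<noteq> {i, j}" by blast
    then show ?thesis
    proof cases
      case 1
      then have "U - {i} = {j}" "U - {j} = {i}" by auto
      with 1 show ?thesis
        by (auto simp: coord_gen_mult uminus_grassmann.rep_eq gen.rep_eq inversion_sign_def inv)
    next
      case 2
      then have "\<not> (i \<in> U \<and> U - {i} = {j})" "\<not> (j \<in> U \<and> U - {j} = {i})" by auto
      then show ?thesis
        using True by (auto simp: coord_gen_mult uminus_grassmann.rep_eq gen.rep_eq)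
    qed
  qed
qed

lemma coord_prod_list_gen:
  assumes "sorted_wrt (<) ks"
  shows "coord (prod_list (map gen ks)) U = (if U = set ks then 1 else 0)"
  using assms
proof (induction ks arbitrary: U)
  case Nil
  show ?case by (simp add: one_grassmann.rep_eq)
next
  case (Cons k ks)
  then have k: "\<forall>l\<in>set ks. k < l" by simp
  show ?case
  proof (cases "finite U")
    case False
    then show ?thesis by (auto simp: coord_infinite)
  next
    case True
    have "k \<notin> set ks" using k by blast
    then have "k \<in> U \<and> U - {k} = set ks \<longleftrightarrow> U = set (k # ks)" by auto
    moreover have "inversion_sign {k} (set ks) = (1::'a)"
    proof -
      have "{(s, t). s \<in> {k} \<and> t \<in> set ks \<and> t < s} = {}" using k by auto
      then show ?thesis by (simp only: inversion_sign_def card.empty power_0)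
    qed
    ultimately show ?thesis
      using Cons True by (auto simp: coord_gen_mult)
  qed
qed


section \<open>The gradings\<close>

text \<open>
  A \<open>\<int>\<close>-graded algebra structure on the Grassmann algebra is given by its family of homogeneous
  components. In \<open>E_grading I m n\<close> the generators indexed by \<open>I\<close> have degree \<open>m\<close> and all others
  degree \<open>n\<close>; it is the grading \<open>E\<^bsub>(m,n)\<^esub>\<close> with superscript \<open>(\<infinity>,\<infinity>)\<close> when both \<open>I\<close> and
  its complement are infinite.
\<close>

definition gen_degree :: "nat set \<Rightarrow> int \<Rightarrow> int \<Rightarrow> nat \<Rightarrow> int" where
  "gen_degree I m n k = (if k \<in> I then m else n)"

definition E_grading :: "nat set \<Rightarrow> int \<Rightarrow> int \<Rightarrow> int \<Rightarrow> 'a::field grassmann set" where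
  "E_grading I m n r = grassmann.span
     {prod_list (map gen ks) | ks. sorted_wrt (<) ks \<and> (\<Sum>k\<leftarrow>ks. gen_degree I m n k) = r}"


section \<open>The free graded algebra and graded identities\<close>

text \<open>
  With concatenation as addition on words, the convolution product of finitely supported functions
  makes \<open>'v list \<Rightarrow>\<^sub>0 'a\<close> the free unitary associative algebra on \<open>'v\<close>.
\<close>

instantiation list :: (type) monoid_add
begin

definition zero_list :: "'a list" where "zero_list = []"

definition plus_list :: "'a list \<Rightarrow> 'a list \<Rightarrow> 'a list" where "plus_list = (@)"

instance by standard (simp_all add: zero_list_def plus_list_def)

end

text \<open>The pair \<open>(i, k)\<close> is the \<open>k\<close>-th variable of degree \<open>i\<close>.\<close>

type_synonym 'a graded_poly = "(int \<times> nat) list \<Rightarrow>\<^sub>0 'a"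

definition subst :: "(int \<times> nat \<Rightarrow> 'a grassmann) \<Rightarrow> 'a::field graded_poly \<Rightarrow> 'a grassmann" where
  "subst \<phi> f = (\<Sum>w\<in>Poly_Mapping.keys f.
     scale_grassmann (Poly_Mapping.lookup f w) (prod_list (map \<phi> w)))"

lemma subst_superset:
  assumes "finite W" "Poly_Mapping.keys f \<subseteq> W"
  shows "subst \<phi> f = (\<Sum>w\<in>W. scale_grassmann (Poly_Mapping.lookup f w) (prod_list (map \<phi> w)))"
  unfolding subst_def using assms
  by (intro sum.mono_neutral_left) (auto simp: in_keys_iff)

lemma subst_add: "subst \<phi> (f + g) = subst \<phi> f + subst \<phi> g"
proof -
  let ?W = "Poly_Mapping.keys f \<union> Poly_Mapping.keys g"
  have "Poly_Mapping.keys (f + g) \<subseteq> ?W" by (rule Poly_Mapping.keys_add)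
  then show ?thesis
    by (simp add: subst_superset[of ?W] lookup_add grassmann.scale_left_distrib sum.distrib)
qed

lemma subst_single:
  "subst \<phi> (Poly_Mapping.single w c) = scale_grassmann c (prod_list (map \<phi> w))"
  by (simp add: subst_superset[of "{w}"])

lemma subst_var: "subst \<phi> (Poly_Mapping.single [v] 1) = \<phi> v"
  by (simp add: subst_single)

lemma subst_one: "subst \<phi> 1 = 1"
  by (simp add: single_one[symmetric] subst_single zero_list_def)

lemma subst_zero: "subst \<phi> 0 = 0"
  by (simp add: subst_def)

lemma graded_poly_induct [case_names zero single sum]:
  fixes P :: "'a::field graded_poly \<Rightarrow> bool"
  assumes "P 0" and "\<And>w c. P (Poly_Mapping.single w c)"
    and "\<And>f g. P f \<Longrightarrow> P g \<Longrightarrow> P (f + g)"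
  shows "P f"
proof (induction f rule: Poly_Mapping.update_induct)
  case const
  show ?case by (rule assms(1))
next
  case (update f w c)
  then have "Poly_Mapping.update w c f = f + Poly_Mapping.single w c"
    by (intro poly_mapping_eqI) (auto simp: lookup_update lookup_add lookup_single in_keys_iff when_def)
  then show ?case using update assms by metis
qed

lemma subst_mult: "subst \<phi> (f * g) = subst \<phi> f * subst \<phi> g"
proof -
  have left_single: "subst \<phi> (Poly_Mapping.single v c * g) =
      subst \<phi> (Poly_Mapping.single v c) * subst \<phi> g" for v c
  proof (induction g rule: graded_poly_induct)
    case zero
    show ?case by (simp add: subst_zero)
  next
    case (single w d)
    then show ?case
      by (simp add: mult_single subst_single plus_list_def
          scale_grassmann_mult_left scale_grassmann_mult_right)
  next
    case (sum f g)
    then show ?case by (simp add: distrib_left subst_add)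
  qed
  show ?thesis
  proof (induction f rule: graded_poly_induct)
    case zero
    show ?case by (simp add: subst_zero)
  next
    case (single w d)
    show ?case by (rule left_single)
  next
    case (sum f g)
    then show ?case by (simp add: distrib_right subst_add)
  qed
qed

definition graded_identities :: "(int \<Rightarrow> 'a::field grassmann set) \<Rightarrow> 'a graded_poly set" where
  "graded_identities A = {f. \<forall>\<phi>. (\<forall>i k. \<phi> (i, k) \<in> A i) \<longrightarrow> subst \<phi> f = 0}"

definition graded_PI_equivalent ::
    "(int \<Rightarrow> 'a::field grassmann set) \<Rightarrow> (int \<Rightarrow> 'a grassmann set) \<Rightarrow> bool" where
  "graded_PI_equivalent A B \<longleftrightarrow> graded_identities A = graded_identities B"

end

theory Submission
  imports Defs "HOL-Library.Multiset" "HOL-Library.Disjoint_Sets"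
begin

text \<open>
  The graded identities of \<open>E_grading I m n\<close> are governed by very little information: which parities
  of length occur among the monomials \<open>e\<^sub>S\<close> of each degree \<open>r\<close>. A monomial with \<open>a\<close> generators of
  degree \<open>m\<close> and \<open>b\<close> of degree \<open>n\<close> has degree \<open>r = a m + b n\<close>. By Bezout such pairs \<open>(a, b)\<close>
  exist for every \<open>r\<close>, and since \<open>m < 0 < n\<close> adding a large multiple of \<open>(n, -m)\<close> makes both
  entries positive without changing \<open>r\<close>. If \<open>m\<close> and \<open>n\<close> are both odd, then \<open>a + b \<equiv> r\<close> modulo 2,
  so each degree carries exactly one parity, the one seen in \<open>(-1, 1)\<close>. Otherwise exactly one of
  \<open>m\<close>, \<open>n\<close> is even, adding \<open>(n, -m)\<close> flips the parity of \<open>a + b\<close>, and each degree carries both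
  parities, as in \<open>(-1, 2)\<close> (\<open>positive_solution_with_parity\<close>). As there are infinitely many
  generators of each degree, every degree and parity that occurs at all occurs on a monomial that
  avoids any given finite set of generators (\<open>realise_degree_and_parity\<close>).

  It remains to see why only parities matter (\<open>graded_identities_mono\<close>). Suppose an admissible
  substitution \<open>\<phi>\<close> for one grading does not kill \<open>f\<close>. Regard each nonconstant monomial \<open>e\<^sub>S\<close> that
  occurs in the value of a variable as a letter, and replace it by a monomial \<open>e\<^sub>T\<close> of the same
  degree in the other grading and of the same parity, the sets \<open>T\<close> of different letters being
  disjoint. This gives an admissible substitution \<open>\<psi>\<close> for the other grading. The new letters commute
  up to the same signs as the old ones, they square to zero, and they satisfy no other relations,
  because products of distinct new letters are, up to sign, distinct basis monomials. Hence there is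
  a linear map sending each word in the new letters to the same word in the old ones
  (\<open>specialisation_exists\<close>). It sends the value of \<open>f\<close> under \<open>\<psi>\<close> to its value under \<open>\<phi>\<close>, so \<open>\<psi>\<close> does
  not kill \<open>f\<close> either.
\<close>

section \<open>The monomial basis\<close>

lift_definition monomial :: "nat set \<Rightarrow> 'a::field grassmann"
  is "\<lambda>S U. if U = S \<and> finite S then 1 else 0"
  by (auto intro: finite_subset[of _ "{S}" for S])

lemma coord_monomial: "finite S \<Longrightarrow> coord (monomial S) U = (if U = S then 1 else 0)"
  by (simp add: monomial.rep_eq)

lemma monomial_empty: "monomial {} = 1"
  by (rule grassmann_eqI) (simp add: coord_monomial one_grassmann.rep_eq)

lemma prod_list_gen_eq_monomial:
  "sorted_wrt (<) ks \<Longrightarrow> prod_list (map gen ks) = monomial (set ks)"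
  by (rule grassmann_eqI) (simp add: coord_prod_list_gen coord_monomial)

lemma coord_sum: "coord (\<Sum>a\<in>A. x a) U = (\<Sum>a\<in>A. coord (x a) U)"
  by (induction A rule: infinite_finite_induct)
    (simp_all add: zero_grassmann.rep_eq plus_grassmann.rep_eq)

lemma monomial_expansion:
  "x = (\<Sum>S | coord x S \<noteq> 0. scale_grassmann (coord x S) (monomial S))"
proof (rule grassmann_eqI)
  fix U
  have "coord (\<Sum>S | coord x S \<noteq> 0. scale_grassmann (coord x S) (monomial S)) U
      = (\<Sum>S | coord x S \<noteq> 0. if S = U then coord x S else 0)"
    unfolding coord_sum
    by (rule sum.cong) (auto simp: scale_grassmann.rep_eq monomial.rep_eq coord_infinite)
  also have "\<dots> = coord x U"
    using finite_coord[of x] by simp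
  finally show "coord x U
      = coord (\<Sum>S | coord x S \<noteq> 0. scale_grassmann (coord x S) (monomial S)) U" ..
qed

lemma scale_minus_one_power: "scale_grassmann ((-1) ^ k) x = (-1) ^ k * x"
  by (cases "even k") simp_all

lemma monomial_mult:
  assumes "finite S" "finite T"
  shows "(monomial S * monomial T :: 'a::field grassmann) =
    (if S \<inter> T = {} then scale_grassmann (inversion_sign S T) (monomial (S \<union> T)) else 0)"
proof (rule grassmann_eqI)
  fix U
  show "coord (monomial S * monomial T :: 'a grassmann) U = coord (if S \<inter> T = {} then
      scale_grassmann (inversion_sign S T) (monomial (S \<union> T)) else 0) U"
  proof (cases "finite U")
    case False
    then show ?thesis by (simp add: coord_infinite)
  next
    case True
    have "coord (monomial S * monomial T :: 'a grassmann) U = (\<Sum>R\<in>Pow U. if R = S then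
        (if U - S = T then inversion_sign S T else 0) else 0 :: 'a)"
      unfolding times_grassmann.rep_eq
      by (rule sum.cong) (use assms in \<open>auto simp: coord_monomial\<close>)
    also have "\<dots> = (if S \<subseteq> U \<and> U - S = T then inversion_sign S T else 0)"
      using True by simp
    also have "S \<subseteq> U \<and> U - S = T \<longleftrightarrow> S \<inter> T = {} \<and> U = S \<union> T"
      by auto
    finally show ?thesis
      using assms by (simp add: scale_grassmann.rep_eq coord_monomial zero_grassmann.rep_eq)
  qed
qed

lemma inversion_sign_commute:
  assumes "finite S" "finite T" "S \<inter> T = {}"
  shows "inversion_sign S T = ((-1) ^ (card S * card T) * inversion_sign T S :: 'a::field)"
proof -
  let ?a = "{(s, t). s \<in> S \<and> t \<in> T \<and> t < s}"
  let ?b = "{(t, s). t \<in> T \<and> s \<in> S \<and> s < t}"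
  have fin: "finite ?a" "finite ?b"
    by (rule finite_subset[of _ "S \<times> T"], use assms in auto)
      (rule finite_subset[of _ "T \<times> S"], use assms in auto)
  \<comment> \<open>Disjointness rules out \<open>s = t\<close>, so each pair is an inversion in exactly one of the two orders.\<close>
  have union: "S \<times> T = ?a \<union> prod.swap ` ?b"
    using assms(3) by (force simp: image_iff)
  have "card S * card T = card (?a \<union> prod.swap ` ?b)"
    by (simp only: card_cartesian_product[symmetric] union)
  also have "\<dots> = card ?a + card (prod.swap ` ?b)"
    by (rule card_Un_disjoint) (use fin in auto)
  also have "card (prod.swap ` ?b) = card ?b"
    by (rule card_image) (simp add: inj_on_def)
  finally have "card S * card T = card ?a + card ?b" .
  then show ?thesis
    by (simp add: inversion_sign_def power_add minus_one_power_iff)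
qed

lemma monomial_commute:
  assumes "finite S" "finite T"
  shows "(monomial S * monomial T :: 'a::field grassmann) =
    (-1) ^ (card S * card T) * (monomial T * monomial S)"
proof (cases "S \<inter> T = {}")
  case True
  then have "(monomial S * monomial T :: 'a grassmann) =
      scale_grassmann (inversion_sign S T) (monomial (T \<union> S))"
    using assms by (simp add: monomial_mult Un_commute[of S T])
  also have "inversion_sign S T = ((-1) ^ (card S * card T) * inversion_sign T S :: 'a)"
    by (rule inversion_sign_commute[OF assms True])
  also have "scale_grassmann \<dots> (monomial (T \<union> S)) = scale_grassmann ((-1) ^ (card S * card T))
      (scale_grassmann (inversion_sign T S) (monomial (T \<union> S)))"
    by simp
  also have "scale_grassmann (inversion_sign T S) (monomial (T \<union> S)) =
      (monomial T * monomial S :: 'a grassmann)"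
    using assms True by (simp add: monomial_mult Int_commute[of T S])
  finally show ?thesis
    unfolding scale_minus_one_power .
qed (use assms in \<open>simp add: monomial_mult Int_commute\<close>)

text \<open>
  Letters with disjoint supports never annihilate each other, so distinct sets of letters give
  linearly independent products. The coefficient is a sign that depends on the order of the letters.
\<close>

lemma prod_list_disjoint_monomials:
  assumes "distinct u" and "\<And>p. p \<in> set u \<Longrightarrow> finite (T p)" and "disjoint_family_on T (set u)"
  shows "\<exists>c :: 'a::field. c \<noteq> 0 \<and> prod_list (map (\<lambda>p. monomial (T p)) u) =
    scale_grassmann c (monomial (\<Union>p\<in>set u. T p))"
  using assms
proof (induction u)
  case Nil
  show ?case by (rule exI[of _ 1]) (simp add: monomial_empty)
next
  case (Cons q u)
  have disj: "disjoint_family_on T (set u)"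
    using Cons.prems(3) by (rule disjoint_family_on_mono[rotated]) auto
  obtain c :: 'a where c: "c \<noteq> 0" "prod_list (map (\<lambda>p. monomial (T p)) u) =
      scale_grassmann c (monomial (\<Union>p\<in>set u. T p))"
    using Cons.IH disj Cons.prems by auto
  have "T q \<inter> (\<Union>p\<in>set u. T p) = {}"
    using Cons.prems(1,3) by (fastforce simp: disjoint_family_on_def)
  then show ?case
    using c Cons.prems
    by (intro exI[of _ "c * inversion_sign (T q) (\<Union>p\<in>set u. T p)"])
      (simp add: scale_grassmann_mult_right monomial_mult inversion_sign_def)
qed

text \<open>
  The components are spans of basis elements, so homogeneity can be read off from the support.
\<close>

lemma mem_E_grading_iff:
  "(x :: 'a::field grassmann) \<in> E_grading I m n r \<longleftrightarrow>
    (\<forall>S. coord x S \<noteq> 0 \<longrightarrow> (\<Sum>k\<in>S. gen_degree I m n k) = r)"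
proof
  assume "x \<in> E_grading I m n r"
  then show "\<forall>S. coord x S \<noteq> 0 \<longrightarrow> (\<Sum>k\<in>S. gen_degree I m n k) = r"
    unfolding E_grading_def
  proof (induction rule: grassmann.span_induct)
    case base
    show ?case
      by (rule grassmann.subspaceI)
        (auto simp: zero_grassmann.rep_eq plus_grassmann.rep_eq scale_grassmann.rep_eq,
          metis add.right_neutral)
  next
    case (step x)
    then obtain ks where ks: "x = prod_list (map gen ks)" "sorted_wrt (<) ks"
      "(\<Sum>k\<leftarrow>ks. gen_degree I m n k) = r" by blast
    have "distinct ks" using ks(2) by (simp add: strict_sorted_iff)
    with ks show ?case
      by (auto simp: coord_prod_list_gen sum_list_distinct_conv_sum_set split: if_splits)
  qed
next
  assume *: "\<forall>S. coord x S \<noteq> 0 \<longrightarrow> (\<Sum>k\<in>S. gen_degree I m n k) = r"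
  have "scale_grassmann (coord x S) (monomial S) \<in> E_grading I m n r" if "coord x S \<noteq> 0" for S
  proof -
    have fin: "finite S" using that coord_infinite by blast
    let ?ks = "sorted_list_of_set S"
    have "(monomial S :: 'a grassmann) = prod_list (map gen ?ks)"
      using fin by (simp add: prod_list_gen_eq_monomial)
    moreover have "(\<Sum>k\<leftarrow>?ks. gen_degree I m n k) = r"
      using fin * that by (simp add: sum_list_distinct_conv_sum_set)
    ultimately show ?thesis
      unfolding E_grading_def
      by (intro grassmann.span_scale grassmann.span_base) force
  qed
  then have "(\<Sum>S | coord x S \<noteq> 0. scale_grassmann (coord x S) (monomial S)) \<in> E_grading I m n r"
    unfolding E_grading_def by (intro grassmann.span_sum) simp
  then show "x \<in> E_grading I m n r"
    using monomial_expansion[of x] by simp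
qed

section \<open>Words in elements that commute up to sign\<close>

text \<open>
  The signs are prescribed by a function \<open>d\<close>, through its parities, rather than by the elements, so that the same
  sign rule can be imposed on two different families at once.
\<close>

definition commute_up_to_sign :: "('p \<Rightarrow> nat) \<Rightarrow> 'p set \<Rightarrow> ('p \<Rightarrow> 'a::ring_1) \<Rightarrow> bool" where
  "commute_up_to_sign d P x \<longleftrightarrow> (\<forall>p\<in>P. \<forall>q\<in>P. x p * x q = (-1) ^ (d p * d q) * (x q * x p))"

lemma minus_one_power_left_commute:
  fixes x :: "'a::ring_1"
  shows "x * ((-1) ^ k * y) = (-1) ^ k * (x * y)"
  by (cases "even k") simp_all

lemma prod_list_commute_up_to_sign:
  assumes "commute_up_to_sign d P x" "p \<in> P" "set u \<subseteq> P"
  shows "prod_list (map x u) * x p = (-1) ^ (sum_list (map d u) * d p) * (x p * prod_list (map x u))"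
  using assms(3)
proof (induction u)
  case Nil
  show ?case by simp
next
  case (Cons q u)
  have "prod_list (map x (q # u)) * x p = x q * (prod_list (map x u) * x p)"
    by (simp add: mult.assoc)
  also have "\<dots> = (-1) ^ (sum_list (map d u) * d p) * ((x q * x p) * prod_list (map x u))"
    using Cons by (simp add: minus_one_power_left_commute[of "x q"] mult.assoc)
  also have "x q * x p = (-1) ^ (d q * d p) * (x p * x q)"
    using assms(1,2) Cons.prems unfolding commute_up_to_sign_def by (meson list.set_intros(1) subsetD)
  finally show ?case
    by (simp add: power_add distrib_right mult.assoc) (rule minus_one_power_left_commute)
qed

text \<open>
  The exponent is chosen before the family \<open>x\<close>: sorting a word costs a sign that depends on the
  letters' parities alone, so two families with the same parities pay the same sign.
\<close>

lemma prod_list_permute_up_to_sign: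
  assumes "mset u = mset w" "set w \<subseteq> P"
  shows "\<exists>k. \<forall>x :: 'p \<Rightarrow> 'a::ring_1. commute_up_to_sign d P x \<longrightarrow>
    prod_list (map x u) = (-1) ^ k * prod_list (map x w)"
  using assms
proof (induction w arbitrary: u)
  case Nil
  then show ?case by (auto intro: exI[of _ 0])
next
  case (Cons p w)
  then have "p \<in> set u" by (metis list.set_intros(1) set_mset_mset)
  then obtain u1 u2 where u: "u = u1 @ p # u2" by (metis split_list)
  then have "mset (u1 @ u2) = mset w" using Cons.prems by simp
  then obtain k where k: "\<And>x :: 'p \<Rightarrow> 'a. commute_up_to_sign d P x \<Longrightarrow>
      prod_list (map x (u1 @ u2)) = (-1) ^ k * prod_list (map x w)"
    using Cons.IH[of "u1 @ u2"] Cons.prems by auto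
  have "set u1 \<subseteq> P" "p \<in> P"
    using Cons.prems u mset_eq_setD[OF Cons.prems(1)] by auto
  then have "prod_list (map x u) = (-1) ^ (sum_list (map d u1) * d p + k) * prod_list (map x (p # w))"
    if "commute_up_to_sign d P x" for x :: "'p \<Rightarrow> 'a"
  proof -
    have "prod_list (map x u) = (prod_list (map x u1) * x p) * prod_list (map x u2)"
      by (simp add: u mult.assoc)
    also have "\<dots> = (-1) ^ (sum_list (map d u1) * d p) * (x p * prod_list (map x (u1 @ u2)))"
      using prod_list_commute_up_to_sign[OF that \<open>p \<in> P\<close> \<open>set u1 \<subseteq> P\<close>]
      by (simp add: mult.assoc)
    finally show ?thesis
      by (simp add: k[OF that] power_add minus_one_power_left_commute[of "x p"] mult.assoc
          del: map_append prod_list.append)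
  qed
  then show ?case by (intro exI allI impI)
qed

text \<open>
  Moving one of the two occurrences next to the other costs a sign and produces a square.
\<close>

lemma prod_list_repeated_letter:
  assumes "commute_up_to_sign d P x" "set u \<subseteq> P" "\<And>p. p \<in> P \<Longrightarrow> x p * x p = 0" "\<not> distinct u"
  shows "prod_list (map x u) = 0"
proof -
  obtain u1 p u2 u3 where u: "u = u1 @ [p] @ u2 @ [p] @ u3"
    using assms(4) not_distinct_decomp by blast
  then have "p \<in> P" "set u2 \<subseteq> P" using assms(2) by auto
  have "prod_list (map x u)
      = prod_list (map x u1) * (x p * (prod_list (map x u2) * x p)) * prod_list (map x u3)"
    by (simp add: u mult.assoc)
  also have "x p * (prod_list (map x u2) * x p)
      = (-1) ^ (sum_list (map d u2) * d p) * ((x p * x p) * prod_list (map x u2))"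
    using prod_list_commute_up_to_sign[OF assms(1) \<open>p \<in> P\<close> \<open>set u2 \<subseteq> P\<close>]
    by (simp add: minus_one_power_left_commute[of "x p"] mult.assoc)
  also have "\<dots> = 0" using assms(3) \<open>p \<in> P\<close> by simp
  finally show ?thesis by simp
qed

section \<open>Specialising monomials with disjoint supports\<close>

text \<open>
  The products of the \<open>monomial (T p)\<close> over the subsets \<open>Q\<close> of \<open>P\<close>, each taken in some fixed order,
  are nonzero multiples of distinct basis monomials, and \<open>\<theta>\<close> may be prescribed on them, sending each
  to the corresponding product of the \<open>monomial (S p)\<close>. Every other word is, up to a sign common to
  both families, one of these or has a repeated letter and vanishes in both. The sets \<open>S p\<close>
  may overlap: extra relations among the images do not obstruct a linear map onto them.
\<close>

lemma specialisation_exists: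
  fixes S T :: "'p \<Rightarrow> nat set"
  assumes "finite P" and "disjoint_family_on T P"
    and T: "\<And>p. p \<in> P \<Longrightarrow> finite (T p) \<and> T p \<noteq> {}"
    and S: "\<And>p. p \<in> P \<Longrightarrow> finite (S p) \<and> S p \<noteq> {}"
    and parity: "\<And>p. p \<in> P \<Longrightarrow> even (card (T p)) \<longleftrightarrow> even (card (S p))"
  obtains \<theta> :: "'a::field grassmann \<Rightarrow> 'a grassmann"
  where "\<And>x y. \<theta> (x + y) = \<theta> x + \<theta> y"
    and "\<And>c x. \<theta> (scale_grassmann c x) = scale_grassmann c (\<theta> x)"
    and "\<And>u. set u \<subseteq> P \<Longrightarrow>
      \<theta> (prod_list (map (\<lambda>p. monomial (T p)) u)) = prod_list (map (\<lambda>p. monomial (S p)) u)"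
proof -
  let ?g = "\<lambda>p. monomial (T p) :: 'a grassmann" and ?e = "\<lambda>p. monomial (S p) :: 'a grassmann"
  let ?d = "\<lambda>p. card (T p)" and ?U = "\<lambda>Q. \<Union>p\<in>Q. T p"
  have fin: "finite Q" if "Q \<subseteq> P" for Q using that assms(1) finite_subset by blast
  define l where "l Q = (SOME l. set l = Q \<and> distinct l)" for Q :: "'p set"
  have l: "set (l Q) = Q \<and> distinct (l Q)" if "finite Q" for Q
    unfolding l_def by (rule someI_ex) (rule finite_distinct_list[OF that])
  define c where "c Q = coord (prod_list (map ?g (l Q))) (?U Q)" for Q
  have g_l: "c Q \<noteq> 0 \<and> prod_list (map ?g (l Q)) = scale_grassmann (c Q) (monomial (?U Q))"
    if Q: "Q \<subseteq> P" for Q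
  proof -
    have "disjoint_family_on T Q" using assms(2) Q by (rule disjoint_family_on_mono[rotated])
    then have "\<exists>b. b \<noteq> 0 \<and> prod_list (map ?g (l Q)) = scale_grassmann b (monomial (?U Q))"
      using prod_list_disjoint_monomials[of "l Q" T, where 'a = 'a] l[OF fin[OF Q]] T Q by auto
    then obtain b where b: "b \<noteq> 0"
        "prod_list (map ?g (l Q)) = scale_grassmann b (monomial (?U Q))" by blast
    have "finite (?U Q)" using fin[OF Q] T Q by blast
    then have "c Q = b" by (simp add: c_def b scale_grassmann.rep_eq coord_monomial)
    then show ?thesis using b by simp
  qed
  \<comment> \<open>Nonemptiness of every \<open>T p\<close> is essential here: a subset is recovered from the union it spans.\<close>
  have U_inj: "Q = Q'" if "Q \<subseteq> P" "Q' \<subseteq> P" "?U Q = ?U Q'" for Q Q'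
  proof -
    have "A \<subseteq> B" if AB: "A \<subseteq> P" "B \<subseteq> P" "?U A = ?U B" for A B
    proof
      fix p assume "p \<in> A"
      then obtain i where "i \<in> T p" using T AB(1) by blast
      then obtain q where "q \<in> B" "i \<in> T q" using \<open>p \<in> A\<close> AB(3) by blast
      then have "p = q"
        using assms(2) \<open>i \<in> T p\<close> \<open>p \<in> A\<close> AB(1,2) unfolding disjoint_family_on_def by blast
      then show "p \<in> B" using \<open>q \<in> B\<close> by simp
    qed
    then show ?thesis using that by (metis subset_antisym)
  qed
  \<comment> \<open>Read off the coordinate at the union of \<open>Q\<close>, normalised by its value on the chosen product.\<close>
  define \<theta> :: "'a grassmann \<Rightarrow> 'a grassmann" where
    "\<theta> x = (\<Sum>Q\<in>Pow P. scale_grassmann (coord x (?U Q) / c Q) (prod_list (map ?e (l Q))))" for x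
  have add: "\<theta> (x + y) = \<theta> x + \<theta> y" for x y
    by (simp add: \<theta>_def plus_grassmann.rep_eq add_divide_distrib
        grassmann.scale_left_distrib sum.distrib)
  have scale: "\<theta> (scale_grassmann b x) = scale_grassmann b (\<theta> x)" for b x
    by (simp add: \<theta>_def scale_grassmann.rep_eq grassmann.scale_sum_right)
  have \<theta>_l: "\<theta> (prod_list (map ?g (l Q))) = prod_list (map ?e (l Q))" if Q: "Q \<subseteq> P" for Q
  proof -
    have "finite (?U Q)" using fin[OF Q] T Q by blast
    then have "coord (prod_list (map ?g (l Q))) (?U R) / c R = (if R = Q then 1 else 0)"
      if "R \<subseteq> P" for R
      using g_l[OF Q] U_inj[OF that Q]
      by (auto simp: scale_grassmann.rep_eq coord_monomial)
    then have "\<theta> (prod_list (map ?g (l Q)))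
        = (\<Sum>R\<in>Pow P. if R = Q then prod_list (map ?e (l Q)) else 0)"
      unfolding \<theta>_def by (intro sum.cong) auto
    then show ?thesis using Q assms(1) by simp
  qed
  have g: "commute_up_to_sign ?d P ?g"
    unfolding commute_up_to_sign_def by (intro ballI monomial_commute) (use T in auto)
  have e: "commute_up_to_sign ?d P ?e"
    unfolding commute_up_to_sign_def
  proof (intro ballI)
    fix p q assume "p \<in> P" "q \<in> P"
    then have "(-1) ^ (card (S p) * card (S q)) = ((-1) ^ (?d p * ?d q) :: 'a grassmann)"
      using parity by (simp add: minus_one_power_iff)
    moreover have "?e p * ?e q = (-1) ^ (card (S p) * card (S q)) * (?e q * ?e p)"
      by (rule monomial_commute) (use S \<open>p \<in> P\<close> \<open>q \<in> P\<close> in auto)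
    ultimately show "?e p * ?e q = (-1) ^ (?d p * ?d q) * (?e q * ?e p)"
      by argo
  qed
  have word: "\<theta> (prod_list (map ?g u)) = prod_list (map ?e u)" if "set u \<subseteq> P" for u
  proof (cases "distinct u")
    case True
    have "set (l (set u)) = set u" "distinct (l (set u))" using l by auto
    then have "mset u = mset (l (set u))"
      using True by (metis set_eq_iff_mset_eq_distinct)
    then have "\<exists>k. \<forall>x :: 'p \<Rightarrow> 'a grassmann. commute_up_to_sign ?d P x \<longrightarrow>
        prod_list (map x u) = (-1) ^ k * prod_list (map x (l (set u)))"
      by (rule prod_list_permute_up_to_sign) (use that \<open>set (l (set u)) = set u\<close> in simp)
    then obtain k where "\<forall>x :: 'p \<Rightarrow> 'a grassmann. commute_up_to_sign ?d P x \<longrightarrow>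
        prod_list (map x u) = (-1) ^ k * prod_list (map x (l (set u)))" ..
    note k = this[rule_format]
    have "\<theta> (prod_list (map ?g u))
        = \<theta> (scale_grassmann ((-1) ^ k) (prod_list (map ?g (l (set u)))))"
      by (simp only: k[OF g] scale_minus_one_power)
    also have "\<dots> = scale_grassmann ((-1) ^ k) (prod_list (map ?e (l (set u))))"
      by (simp only: scale \<theta>_l[OF that])
    also have "\<dots> = prod_list (map ?e u)"
      by (simp only: k[OF e] scale_minus_one_power)
    finally show ?thesis .
  next
    case False
    have "prod_list (map ?g u) = 0"
      by (rule prod_list_repeated_letter[OF g that _ False]) (use T in \<open>simp add: monomial_mult\<close>)
    moreover have "prod_list (map ?e u) = 0"
      by (rule prod_list_repeated_letter[OF e that _ False]) (use S in \<open>simp add: monomial_mult\<close>)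
    moreover have "\<theta> 0 = 0"
      using scale[of 0 0] by simp
    ultimately show ?thesis by (simp only:)
  qed
  show thesis by (rule that[OF add scale word])
qed

section \<open>Parallel evaluations\<close>

text \<open>
  Two elements are parallel if they arise from one and the same noncommutative polynomial in the
  letters of \<open>P\<close>, evaluated once at \<open>g\<close> and once at \<open>e\<close>. This relation is the subalgebra of \<open>E \<times> E\<close>
  generated by the pairs \<open>(g p, e p)\<close>; being parallel passes from the values of the variables to the
  value of a polynomial without any multinomial expansion.
\<close>

inductive parallel :: "'p set \<Rightarrow> ('p \<Rightarrow> 'a::field grassmann) \<Rightarrow> ('p \<Rightarrow> 'a grassmann) \<Rightarrow>
    'a grassmann \<Rightarrow> 'a grassmann \<Rightarrow> bool" for P g e where
  word: "set u \<subseteq> P \<Longrightarrow> parallel P g e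
    (scale_grassmann c (prod_list (map g u))) (scale_grassmann c (prod_list (map e u)))"
| add: "parallel P g e x x' \<Longrightarrow> parallel P g e y y' \<Longrightarrow> parallel P g e (x + y) (x' + y')"

lemma parallel_scalar: "parallel P g e (scale_grassmann c 1) (scale_grassmann c 1)"
  using parallel.word[of "[]" P g e c] by simp

lemma parallel_letter:
  "p \<in> P \<Longrightarrow> parallel P g e (scale_grassmann c (g p)) (scale_grassmann c (e p))"
  using parallel.word[of "[p]" P g e c] by simp

lemma parallel_mult:
  assumes "parallel P g e x x'" "parallel P g e y y'"
  shows "parallel P g e (x * y) (x' * y')"
  using assms(1)
proof induction
  case (word u c)
  from assms(2) show ?case
  proof induction
    case (word w d)
    then show ?case
      using parallel.word[of "u @ w" P g e "d * c"] \<open>set u \<subseteq> P\<close>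
      by (simp add: scale_grassmann_mult_left scale_grassmann_mult_right)
  qed (simp add: distrib_left parallel.add)
qed (simp add: distrib_right parallel.add)

lemma parallel_sum:
  "(\<And>a. a \<in> A \<Longrightarrow> parallel P g e (x a) (y a)) \<Longrightarrow> parallel P g e (\<Sum>a\<in>A. x a) (\<Sum>a\<in>A. y a)"
  by (induction A rule: infinite_finite_induct)
    (use parallel_scalar[of P g e 0] in \<open>simp_all add: parallel.add\<close>)

lemma parallel_prod_list:
  "(\<And>v. v \<in> set w \<Longrightarrow> parallel P g e (\<psi> v) (\<phi> v)) \<Longrightarrow>
    parallel P g e (prod_list (map \<psi> w)) (prod_list (map \<phi> w))"
  by (induction w) (use parallel_scalar[of P g e 1] in \<open>simp_all add: parallel_mult\<close>)

lemma parallel_subst: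
  assumes "\<And>w v. w \<in> Poly_Mapping.keys f \<Longrightarrow> v \<in> set w \<Longrightarrow> parallel P g e (\<psi> v) (\<phi> v)"
  shows "parallel P g e (subst \<psi> f) (subst \<phi> f)"
  unfolding subst_def
proof (rule parallel_sum)
  fix w assume "w \<in> Poly_Mapping.keys f"
  then have "parallel P g e (prod_list (map \<psi> w)) (prod_list (map \<phi> w))"
    using assms by (intro parallel_prod_list) auto
  then show "parallel P g e (scale_grassmann (Poly_Mapping.lookup f w) (prod_list (map \<psi> w)))
      (scale_grassmann (Poly_Mapping.lookup f w) (prod_list (map \<phi> w)))"
    using parallel_mult[OF parallel_scalar] by (metis mult_1 scale_grassmann_mult_left)
qed

text \<open>
  A linear specialisation maps the first component of every parallel pair to the second, so that the
  second component is a function of the first.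
\<close>

lemma parallel_zero:
  fixes S T :: "'p \<Rightarrow> nat set"
  assumes "finite P" "disjoint_family_on T P"
    and "\<And>p. p \<in> P \<Longrightarrow> finite (T p) \<and> T p \<noteq> {}"
    and "\<And>p. p \<in> P \<Longrightarrow> finite (S p) \<and> S p \<noteq> {}"
    and "\<And>p. p \<in> P \<Longrightarrow> even (card (T p)) \<longleftrightarrow> even (card (S p))"
    and "parallel P (\<lambda>p. monomial (T p)) (\<lambda>p. monomial (S p)) 0 (y :: 'a::field grassmann)"
  shows "y = 0"
proof (rule specialisation_exists[OF assms(1-5), where 'a = 'a])
  fix \<theta> :: "'a grassmann \<Rightarrow> 'a grassmann"
  assume add: "\<And>x y. \<theta> (x + y) = \<theta> x + \<theta> y"
    and scale: "\<And>c x. \<theta> (scale_grassmann c x) = scale_grassmann c (\<theta> x)"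
    and word: "\<And>u. set u \<subseteq> P \<Longrightarrow>
      \<theta> (prod_list (map (\<lambda>p. monomial (T p)) u)) = prod_list (map (\<lambda>p. monomial (S p)) u)"
  have "\<theta> x = z" if "parallel P (\<lambda>p. monomial (T p)) (\<lambda>p. monomial (S p)) x z" for x z
    using that by induction (simp_all add: add scale word)
  then have "y = \<theta> 0" using assms(6) by simp
  then show "y = 0" using scale[of 0 0] by simp
qed

section \<open>Graded identities depend only on the realisable parities\<close>

lemma disjoint_choice:
  assumes "finite P" and "\<And>p X. p \<in> P \<Longrightarrow> finite X \<Longrightarrow> \<exists>T. finite T \<and> T \<inter> X = {} \<and> R p T"
  shows "\<exists>T. disjoint_family_on T P \<and> (\<forall>p\<in>P. finite (T p) \<and> R p (T p))"
  using assms
proof (induction P)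
  case empty
  show ?case by (simp add: disjoint_family_on_def)
next
  case (insert q P)
  then obtain T where T: "disjoint_family_on T P" "\<forall>p\<in>P. finite (T p) \<and> R p (T p)"
    by (metis insertCI)
  have "finite (\<Union>p\<in>P. T p)" using insert.hyps T by blast
  then obtain T' where T': "finite T'" "T' \<inter> (\<Union>p\<in>P. T p) = {}" "R q T'"
    using insert.prems[of q "\<Union>p\<in>P. T p"] by auto
  have "disjoint_family_on (T(q := T')) (insert q P)"
    using T(1) T'(2) insert.hyps(2) by (auto simp: disjoint_family_on_def)
  moreover have "\<forall>p\<in>insert q P. finite ((T(q := T')) p) \<and> R p ((T(q := T')) p)"
    using T(2) T' by simp
  ultimately show ?case by blast
qed

text \<open>
  The transfer of a nonvanishing substitution. Constant terms need separate treatment: the empty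
  monomial does not square to zero and is not a letter. It can only occur in the value of a variable
  of degree 0, and there it is kept as it is, since \<open>1\<close> has degree 0 in every grading.
\<close>

lemma graded_identities_mono:
  assumes realise: "\<And>S X. \<lbrakk>finite S; S \<noteq> {}; finite X\<rbrakk> \<Longrightarrow>
      \<exists>T. finite T \<and> T \<inter> X = {} \<and> T \<noteq> {} \<and> (even (card T) \<longleftrightarrow> even (card S)) \<and>
        (\<Sum>k\<in>T. gen_degree J m' n' k) = (\<Sum>k\<in>S. gen_degree I m n k)"
  shows "graded_identities (E_grading J m' n' :: int \<Rightarrow> 'a::field grassmann set)
    \<subseteq> graded_identities (E_grading I m n)"
proof
  fix f :: "'a graded_poly"
  assume f: "f \<in> graded_identities (E_grading J m' n')"
  have "subst \<phi> f = 0" if \<phi>: "\<And>i k. \<phi> (i, k) \<in> E_grading I m n i" for \<phi>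
  proof -
    \<comment> \<open>The substitution is altered only on variables of \<open>f\<close>, which keeps the set of letters finite.\<close>
    define V where "V = (\<Union>w\<in>Poly_Mapping.keys f. set w)"
    define supp where "supp v = {S. coord (\<phi> v) S \<noteq> 0} - {{}}" for v
    define P where "P = Sigma V supp"
    have fin_supp: "finite (supp v)" for v
      unfolding supp_def using finite_coord by blast
    then have "finite P" unfolding P_def V_def by auto
    have S: "finite (snd p) \<and> snd p \<noteq> {}" if "p \<in> P" for p
      using that coord_infinite unfolding P_def supp_def by fastforce
    have "\<exists>T. disjoint_family_on T P \<and> (\<forall>p\<in>P. finite (T p) \<and> (T p \<noteq> {} \<and>
        (even (card (T p)) \<longleftrightarrow> even (card (snd p))) \<and>
        (\<Sum>k\<in>T p. gen_degree J m' n' k) = (\<Sum>k\<in>snd p. gen_degree I m n k)))"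
      by (rule disjoint_choice) (use \<open>finite P\<close> S realise in auto)
    then obtain T where disj: "disjoint_family_on T P"
      and T: "\<And>p. p \<in> P \<Longrightarrow> finite (T p) \<and> T p \<noteq> {}"
      and parity: "\<And>p. p \<in> P \<Longrightarrow> even (card (T p)) \<longleftrightarrow> even (card (snd p))"
      and degree: "\<And>p. p \<in> P \<Longrightarrow>
        (\<Sum>k\<in>T p. gen_degree J m' n' k) = (\<Sum>k\<in>snd p. gen_degree I m n k)"
      by metis
    define \<psi> where "\<psi> v = (if v \<in> V then scale_grassmann (coord (\<phi> v) {}) 1 +
      (\<Sum>S\<in>supp v. scale_grassmann (coord (\<phi> v) S) (monomial (T (v, S)))) else 0)" for v
    have \<phi>_degree: "(\<Sum>k\<in>S. gen_degree I m n k) = fst v" if "coord (\<phi> v) S \<noteq> 0" for v S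
      using \<phi>[of "fst v" "snd v"] that by (simp add: mem_E_grading_iff)
    have \<psi>: "\<psi> v \<in> E_grading J m' n' (fst v)" for v
    proof (cases "v \<in> V")
      case False
      then show ?thesis by (simp add: \<psi>_def mem_E_grading_iff zero_grassmann.rep_eq)
    next
      case True
      have "scale_grassmann (coord (\<phi> v) {}) 1 \<in> E_grading J m' n' (fst v)"
        using \<phi>_degree[of v "{}"]
        by (auto simp: mem_E_grading_iff scale_grassmann.rep_eq one_grassmann.rep_eq)
      moreover have "scale_grassmann (coord (\<phi> v) S) (monomial (T (v, S)))
          \<in> E_grading J m' n' (fst v)" if "S \<in> supp v" for S
      proof -
        have "(v, S) \<in> P" using True that by (simp add: P_def)
        moreover have "(\<Sum>k\<in>S. gen_degree I m n k) = fst v"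
          using that \<phi>_degree unfolding supp_def by blast
        ultimately show ?thesis
          using degree[of "(v, S)"]
          by (auto simp: mem_E_grading_iff scale_grassmann.rep_eq monomial.rep_eq)
      qed
      ultimately show ?thesis
        unfolding \<psi>_def E_grading_def using True
        by (simp add: grassmann.span_add grassmann.span_sum)
    qed
    have "\<psi> (i, k) \<in> E_grading J m' n' i" for i k
      using \<psi>[of "(i, k)"] by simp
    then have "subst \<psi> f = 0"
      using f by (simp add: graded_identities_def)
    have "parallel P (\<lambda>p. monomial (T p)) (\<lambda>p. monomial (snd p)) (subst \<psi> f) (subst \<phi> f)"
    proof (rule parallel_subst)
      fix w v assume "w \<in> Poly_Mapping.keys f" "v \<in> set w"
      then have "v \<in> V" unfolding V_def by blast
      have "\<phi> v = (\<Sum>S\<in>insert {} (supp v). scale_grassmann (coord (\<phi> v) S) (monomial S))"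
        by (subst monomial_expansion, rule sum.mono_neutral_left)
          (use fin_supp in \<open>auto simp: supp_def\<close>)
      also have "\<dots> = scale_grassmann (coord (\<phi> v) {}) 1 +
          (\<Sum>S\<in>supp v. scale_grassmann (coord (\<phi> v) S) (monomial S))"
        using fin_supp by (subst sum.insert) (auto simp: monomial_empty supp_def)
      finally have \<phi>_v: "\<phi> v = scale_grassmann (coord (\<phi> v) {}) 1 +
          (\<Sum>S\<in>supp v. scale_grassmann (coord (\<phi> v) S) (monomial S))" .
      have "parallel P (\<lambda>p. monomial (T p)) (\<lambda>p. monomial (snd p))
          (\<Sum>S\<in>supp v. scale_grassmann (coord (\<phi> v) S) (monomial (T (v, S))))
          (\<Sum>S\<in>supp v. scale_grassmann (coord (\<phi> v) S) (monomial S))"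
      proof (rule parallel_sum)
        fix S assume "S \<in> supp v"
        then have "(v, S) \<in> P" using \<open>v \<in> V\<close> by (simp add: P_def)
        from parallel_letter[OF this, of "\<lambda>p. monomial (T p)" "\<lambda>p. monomial (snd p)"]
        show "parallel P (\<lambda>p. monomial (T p)) (\<lambda>p. monomial (snd p))
            (scale_grassmann (coord (\<phi> v) S) (monomial (T (v, S))))
            (scale_grassmann (coord (\<phi> v) S) (monomial S))" by simp
      qed
      from parallel.add[OF parallel_scalar this, of "coord (\<phi> v) {}"]
      show "parallel P (\<lambda>p. monomial (T p)) (\<lambda>p. monomial (snd p)) (\<psi> v) (\<phi> v)"
        unfolding \<phi>_v[symmetric] using \<open>v \<in> V\<close> by (simp add: \<psi>_def)
    qed
    then show ?thesis
      using parallel_zero[OF \<open>finite P\<close> disj T S parity] \<open>subst \<psi> f = 0\<close> by simp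
  qed
  then show "f \<in> graded_identities (E_grading I m n)"
    unfolding graded_identities_def by blast
qed

section \<open>Which parities a degree realises\<close>

lemma sum_gen_degree:
  assumes "finite S"
  shows "(\<Sum>k\<in>S. gen_degree I m n k) = int (card (S \<inter> I)) * m + int (card (S - I)) * n"
proof -
  have "(\<Sum>k\<in>S. gen_degree I m n k) =
      (\<Sum>k\<in>S \<inter> I. gen_degree I m n k) + (\<Sum>k\<in>S - I. gen_degree I m n k)"
    using assms by (metis sum.Int_Diff)
  then show ?thesis by (simp add: gen_degree_def)
qed

lemma even_degree_iff:
  assumes "finite S" "odd m" "odd n"
  shows "even (\<Sum>k\<in>S. gen_degree I m n k) \<longleftrightarrow> even (card S)"
proof -
  have "card S = card (S \<inter> I) + card (S - I)"
    using assms(1) by (metis Int_Diff_Un Int_Diff_disjoint card_Un_disjoint finite_Diff finite_Int)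
  then show ?thesis using assms by (simp add: sum_gen_degree)
qed

text \<open>
  The solutions of \<open>a m + b n = r\<close> form a line with direction \<open>(n, -m)\<close>, whose entries are positive.
  One step along it changes \<open>a + b\<close> by \<open>n - m\<close>, which is odd unless \<open>m\<close> and \<open>n\<close> are both odd (both
  even being impossible); so going far enough, and if necessary one step further, gives positive
  numbers of the wanted parity.
\<close>

lemma positive_solution_with_parity:
  fixes m n r :: int
  assumes "m < 0" "0 < n" "coprime m n" and "odd m \<and> odd n \<Longrightarrow> even r \<longleftrightarrow> even s"
  obtains a b :: nat where "0 < a" "0 < b" "int a * m + int b * n = r"
    "even (a + b) \<longleftrightarrow> even (s::nat)"
proof -
  obtain a0 b0 where "a0 * m + b0 * n = 1"
    using bezout_int[of m n] assms(3) by auto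
  then have "(r * a0) * m + (r * b0) * n = r"
    by (metis distrib_left mult.assoc mult.right_neutral)
  then obtain a1 b1 where ab: "a1 * m + b1 * n = r" by blast
  \<comment> \<open>Both entries grow by at least 1 per step, so this many steps outweigh \<open>a1\<close> and \<open>b1\<close>.\<close>
  define t0 where "t0 = \<bar>a1\<bar> + \<bar>b1\<bar> + 1"
  define t where "t = (if even (a1 + b1 + t0 * (n - m)) \<longleftrightarrow> even s then t0 else t0 + 1)"
  define a where "a = a1 + t * n"
  define b where "b = b1 - t * m"
  have t: "t0 \<le> t" "0 \<le> t" unfolding t_def t0_def by auto
  have "t \<le> t * n" "t \<le> t * - m"
    using t assms mult_left_mono[of 1 n t] mult_left_mono[of 1 "- m" t] by auto
  then have pos: "0 < a" "0 < b" using t unfolding a_def b_def t0_def by auto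
  have deg: "a * m + b * n = r" using ab by (simp add: a_def b_def algebra_simps)
  have "even (a + b) \<longleftrightarrow> even s"
  proof (cases "odd m \<and> odd n")
    case True
    then have "even (a + b) \<longleftrightarrow> even r" unfolding deg[symmetric] by simp
    then show ?thesis using assms(4) True by simp
  next
    case False
    then have "odd (n - m)"
      using coprime_common_divisor[OF assms(3), of 2] by auto
    moreover have "a + b = a1 + b1 + t * (n - m)" by (simp add: a_def b_def algebra_simps)
    ultimately show ?thesis by (auto simp: t_def)
  qed
  moreover have "even (nat a + nat b) \<longleftrightarrow> even (a + b)"
    using pos by (simp add: even_nat_iff)
  ultimately show thesis
    using that[of "nat a" "nat b"] pos deg by simp
qed

lemma realise_degree_and_parity:
  fixes m n r :: int
  assumes "m < 0" "0 < n" "coprime m n" "infinite I" "infinite (- I)" "finite X"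
    and "odd m \<and> odd n \<Longrightarrow> even r \<longleftrightarrow> even (s::nat)"
  shows "\<exists>T. finite T \<and> T \<inter> X = {} \<and> T \<noteq> {} \<and> (even (card T) \<longleftrightarrow> even s) \<and>
    (\<Sum>k\<in>T. gen_degree I m n k) = r"
proof -
  obtain a b where ab: "0 < a" "int a * m + int b * n = r" "even (a + b) \<longleftrightarrow> even s"
    using positive_solution_with_parity[OF assms(1-3,7)] by metis
  have "infinite (I - X)" "infinite (- I - X)" using assms(4-6) by auto
  then obtain A B where A: "A \<subseteq> I - X" "finite A" "card A = a"
    and B: "B \<subseteq> - I - X" "finite B" "card B = b"
    by (metis infinite_arbitrarily_large)
  have "(A \<union> B) \<inter> I = A" "(A \<union> B) - I = B" "A \<inter> B = {}" using A(1) B(1) by auto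
  then have "(\<Sum>k\<in>A \<union> B. gen_degree I m n k) = r" "card (A \<union> B) = a + b"
    using A B ab(2) by (simp_all add: sum_gen_degree card_Un_disjoint)
  moreover have "(A \<union> B) \<inter> X = {}" "A \<union> B \<noteq> {}" using A B ab(1) by auto
  ultimately show ?thesis
    using A(2) B(2) ab(3) by (intro exI[of _ "A \<union> B"]) simp
qed

text \<open>
  When \<open>m\<close> and \<open>n\<close> are both odd, the degree of a monomial determines the parity of its length, which is
  then the only parity the other grading has to supply. Otherwise the other grading supplies both.
\<close>

lemma graded_identities_subset:
  fixes m n m' n' :: int
  assumes "odd m \<and> odd n \<longleftrightarrow> odd m' \<and> odd n'"
    and "m' < 0" "0 < n'" "coprime m' n'" "infinite J" "infinite (- J)"
  shows "graded_identities (E_grading J m' n' :: int \<Rightarrow> 'a::field grassmann set)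
    \<subseteq> graded_identities (E_grading I m n)"
proof (rule graded_identities_mono)
  fix S X :: "nat set"
  assume "finite S" "finite X"
  show "\<exists>T. finite T \<and> T \<inter> X = {} \<and> T \<noteq> {} \<and> (even (card T) \<longleftrightarrow> even (card S)) \<and>
        (\<Sum>k\<in>T. gen_degree J m' n' k) = (\<Sum>k\<in>S. gen_degree I m n k)"
    by (rule realise_degree_and_parity[OF assms(2-6) \<open>finite X\<close>])
      (use assms(1) even_degree_iff[OF \<open>finite S\<close>] in blast)
qed

theorem theorem4p1:
  fixes m n :: int and I J K :: "nat set"
  assumes "m < 0" and "0 < n" and "gcd m n = 1"
    and "infinite I" and "infinite (- I)"
    and "infinite J" and "infinite (- J)"
    and "infinite K" and "infinite (- K)"
  shows "graded_PI_equivalent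
           (E_grading I m n :: int \<Rightarrow> 'a::field_char_0 grassmann set) (E_grading J (-1) 1)
       \<or> graded_PI_equivalent
           (E_grading I m n :: int \<Rightarrow> 'a::field_char_0 grassmann set) (E_grading K (-1) 2)"
proof -
  have co: "coprime m n" using assms(3) by (simp add: coprime_iff_gcd_eq_1)
  note from_mn = graded_identities_subset[OF _ assms(1,2) co assms(4,5)]
  show ?thesis
  proof (cases "odd m \<and> odd n")
    case True
    then show ?thesis
      unfolding graded_PI_equivalent_def
      by (intro disjI1 subset_antisym from_mn graded_identities_subset) (use assms in auto)
  next
    case False
    then show ?thesis
      unfolding graded_PI_equivalent_def
      by (intro disjI2 subset_antisym from_mn graded_identities_subset) (use assms in auto)
  qed
qed

end
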